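(* Let $n\geq3$, let $b,c,x,y\in\mathbb{C}$ with $b\neq0$, $c\neq0$, $x^2-\frac{cy^2}{b}\neq0$, and let $\rho_3: SB_n\to\mathrm{GL}_n(\mathbb{C})$ be the representation given, for $1\le i\le n-1$, by $$\rho_3(\sigma_i)=I_{i-1}\oplus\begin{pmatrix}0&b\\c&0\end{pmatrix}\oplus I_{n-i-1},\qquad \rho_3(\tau_i)=I_{i-1}\oplus\begin{pmatrix}x&y\\\frac{cy}{b}&x\end{pmatrix}\oplus I_{n-i-1}.$$ If $bc\neq1$, then $\rho_3$ is irreducible. Moreover, if $bc=1$, then $\rho_3$ is irreducible if and only if $x+\frac{y}{b}\neq1$.
   Context: The singular braid group $SB_n$ is the group generated by $\sigma_1,\dots,\sigma_{n-1},\tau_1,\dots,\tau_{n-1}$ with defining relations: $\sigma_i\sigma_{i+1}\sigma_i=\sigma_{i+1}\sigma_i\sigma_{i+1}$, $\sigma_i\sigma_{i+1}\tau_i=\tau_{i+1}\sigma_i\sigma_{i+1}$ and $\sigma_{i+1}\sigma_i\tau_{i+1}=\tau_i\sigma_{i+1}\sigma_i$ for $1\le i\le n-2$; $\tau_i\sigma_i=\sigma_i\tau_i$ for $1\le i\le n-1$; and $\sigma_i\sigma_j=\sigma_j\sigma_i$, $\tau_i\tau_j=\tau_j\tau_i$, $\tau_i\sigma_j=\sigma_j\tau_i$ for $|i-j|\ge2$. $I_r$ is the $r\times r$ identity matrix and $\oplus$ denotes the block-diagonal sum of matrices. A representation $G\to\mathrm{GL}_m(\mathbb{C})$ is irreducible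 if no subspace of $\mathbb{C}^m$ other than $0$ and $\mathbb{C}^m$ is invariant under the image of $G$. *)

theory Defs
  imports "Jordan_Normal_Form.VS_Connect"
begin

section \<open>Groups given by generators and relations\<close>

text \<open>A word is a list of letters \<open>(a, e)\<close>, where \<open>(a, True)\<close> stands for the generator \<open>a\<close> and
  \<open>(a, False)\<close> for its formal inverse.\<close>

type_synonym 'a gword = "('a \<times> bool) list"

abbreviation gwords :: "'a set \<Rightarrow> 'a gword set" where
  "gwords S \<equiv> lists (S \<times> UNIV)"

text \<open>The least congruence on the words over \<open>S\<close> that contains the relations \<open>R\<close> and the free
  cancellations; a pair \<open>(u, v)\<close> in \<open>R\<close> is the relation \<open>u = v\<close>.\<close>

inductive_set pres_rel ::
    "'a set \<Rightarrow> ('a gword \<times> 'a gword) set \<Rightarrow> ('a gword \<times> 'a gword) set"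
  for S R where
  refl: "w \<in> gwords S \<Longrightarrow> (w, w) \<in> pres_rel S R"
| sym: "(u, v) \<in> pres_rel S R \<Longrightarrow> (v, u) \<in> pres_rel S R"
| trans: "(u, v) \<in> pres_rel S R \<Longrightarrow> (v, w) \<in> pres_rel S R \<Longrightarrow> (u, w) \<in> pres_rel S R"
| rel: "(u, v) \<in> R \<Longrightarrow> u \<in> gwords S \<Longrightarrow> v \<in> gwords S \<Longrightarrow> p \<in> gwords S \<Longrightarrow> q \<in> gwords S
    \<Longrightarrow> (p @ u @ q, p @ v @ q) \<in> pres_rel S R"
| cancel: "a \<in> S \<Longrightarrow> p \<in> gwords S \<Longrightarrow> q \<in> gwords S
    \<Longrightarrow> (p @ [(a, e), (a, \<not> e)] @ q, p @ q) \<in> pres_rel S R"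

definition presented_group ::
    "'a set \<Rightarrow> ('a gword \<times> 'a gword) set \<Rightarrow> 'a gword set monoid" where
  "presented_group S R = \<lparr>
     carrier = gwords S // pres_rel S R,
     mult = (\<lambda>A B. \<Union>u\<in>A. \<Union>v\<in>B. pres_rel S R `` {u @ v}),
     one = pres_rel S R `` {[]}\<rparr>"

lemma pres_rel_gwords: "(u, v) \<in> pres_rel S R \<Longrightarrow> u \<in> gwords S \<and> v \<in> gwords S"
  by (induction rule: pres_rel.induct) auto

lemma equiv_pres_rel: "equiv (gwords S) (pres_rel S R)"
proof (rule equivI)
  show "pres_rel S R \<subseteq> gwords S \<times> gwords S"
    by (intro subrelI SigmaI) (simp_all only: pres_rel_gwords)
  show "refl_on (gwords S) (pres_rel S R)"
    by (simp add: refl_on_def pres_rel.refl)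
  show "Relation.sym (pres_rel S R)" "Relation.trans (pres_rel S R)"
    by (rule symI, erule pres_rel.sym) (rule transI, erule (1) pres_rel.trans)
qed

lemma pres_rel_append_right:
  assumes "(u, v) \<in> pres_rel S R" "w \<in> gwords S"
  shows "(u @ w, v @ w) \<in> pres_rel S R"
  using assms(1)
proof (induction rule: pres_rel.induct)
  case (rel u v p q)
  then show ?case using pres_rel.rel[of u v R S p "q @ w"] assms(2) by simp
next
  case (cancel a p q e)
  then show ?case using pres_rel.cancel[of a S p "q @ w" e R] assms(2) by simp
next
  case (refl u)
  then show ?case using assms(2) by (intro pres_rel.refl) auto
qed (erule pres_rel.sym, erule (1) pres_rel.trans)

lemma pres_rel_append_left:
  assumes "(u, v) \<in> pres_rel S R" "w \<in> gwords S"
  shows "(w @ u, w @ v) \<in> pres_rel S R"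
  using assms(1)
proof (induction rule: pres_rel.induct)
  case (rel u v p q)
  then show ?case using pres_rel.rel[of u v R S "w @ p" q] assms(2) by simp
next
  case (cancel a p q e)
  then show ?case using pres_rel.cancel[of a S "w @ p" q e R] assms(2) by simp
next
  case (refl u)
  then show ?case using assms(2) by (intro pres_rel.refl) auto
qed (erule pres_rel.sym, erule (1) pres_rel.trans)

lemma pres_rel_append:
  assumes "(u, u') \<in> pres_rel S R" "(v, v') \<in> pres_rel S R"
  shows "(u @ v, u' @ v') \<in> pres_rel S R"
proof (rule pres_rel.trans)
  show "(u @ v, u' @ v) \<in> pres_rel S R"
    using assms pres_rel_gwords[OF assms(2)] by (blast intro: pres_rel_append_right)
  show "(u' @ v, u' @ v') \<in> pres_rel S R"
    using assms pres_rel_gwords[OF assms(1)] by (blast intro: pres_rel_append_left)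
qed

lemma presented_group_mult:
  assumes "u \<in> gwords S" "v \<in> gwords S"
  shows "mult (presented_group S R) (pres_rel S R `` {u}) (pres_rel S R `` {v})
    = pres_rel S R `` {u @ v}"
proof -
  have "pres_rel S R `` {u' @ v'} = pres_rel S R `` {u @ v}"
    if "u' \<in> pres_rel S R `` {u}" "v' \<in> pres_rel S R `` {v}" for u' v'
    using that
    by (intro equiv_class_eq[OF equiv_pres_rel, symmetric] pres_rel_append) simp_all
  moreover have "u \<in> pres_rel S R `` {u}" "v \<in> pres_rel S R `` {v}"
    using assms equiv_class_self[OF equiv_pres_rel] by blast+
  ultimately have "(\<Union>u'\<in>pres_rel S R `` {u}. \<Union>v'\<in>pres_rel S R `` {v}. pres_rel S R `` {u' @ v'})
      = pres_rel S R `` {u @ v}"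
    by blast
  then show ?thesis
    by (simp add: presented_group_def)
qed

lemma presented_group_carrierE:
  assumes "A \<in> carrier (presented_group S R)"
  obtains u where "u \<in> gwords S" "A = pres_rel S R `` {u}"
proof -
  have "A \<in> gwords S // pres_rel S R" using assms by (simp add: presented_group_def)
  then show thesis by (rule quotientE) (rule that)
qed

lemma presented_group_carrierI:
  "u \<in> gwords S \<Longrightarrow> pres_rel S R `` {u} \<in> carrier (presented_group S R)"
  by (simp add: presented_group_def quotientI del: in_lists_conv_set)

lemma inverse_gword:
  "u \<in> gwords S \<Longrightarrow> map (\<lambda>(a, e). (a, \<not> e)) (rev u) \<in> gwords S"
  unfolding in_lists_conv_set by fastforce

lemma pres_rel_left_inverse:
  assumes "u \<in> gwords S"
  shows "(map (\<lambda>(a, e). (a, \<not> e)) (rev u) @ u, []) \<in> pres_rel S R"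
  using assms
proof (induction u)
  case Nil
  then show ?case by (simp add: pres_rel.refl)
next
  case (Cons l u)
  obtain a e where l: "l = (a, e)" by (cases l)
  let ?i = "map (\<lambda>(a, e). (a, \<not> e)) (rev u)"
  have a: "a \<in> S" and u: "u \<in> gwords S" using Cons.hyps l by simp_all
  have "(?i @ [(a, \<not> e), (a, \<not> \<not> e)] @ u, ?i @ u) \<in> pres_rel S R"
    using a inverse_gword[OF u] u by (rule pres_rel.cancel)
  from pres_rel.trans[OF this Cons.IH] show ?case using l by simp
qed

lemma group_presented_group: "group (presented_group S R)"
proof (rule groupI)
  let ?G = "presented_group S R" and ?c = "\<lambda>u. pres_rel S R `` {u}"
  have one: "\<one>\<^bsub>?G\<^esub> = ?c []" by (simp add: presented_group_def)
  show "\<one>\<^bsub>?G\<^esub> \<in> carrier ?G" unfolding one by (rule presented_group_carrierI) simp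
  show "A \<otimes>\<^bsub>?G\<^esub> B \<in> carrier ?G" if A: "A \<in> carrier ?G" and B: "B \<in> carrier ?G" for A B
  proof -
    obtain u where u: "u \<in> gwords S" "A = ?c u" using A by (rule presented_group_carrierE)
    obtain v where v: "v \<in> gwords S" "B = ?c v" using B by (rule presented_group_carrierE)
    from u v have "u @ v \<in> gwords S" by simp
    then show ?thesis
      unfolding u v presented_group_mult[OF u(1) v(1)] by (rule presented_group_carrierI)
  qed
  show "A \<otimes>\<^bsub>?G\<^esub> B \<otimes>\<^bsub>?G\<^esub> C = A \<otimes>\<^bsub>?G\<^esub> (B \<otimes>\<^bsub>?G\<^esub> C)"
    if A: "A \<in> carrier ?G" and B: "B \<in> carrier ?G" and C: "C \<in> carrier ?G" for A B C
  proof -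
    obtain u where u: "u \<in> gwords S" "A = ?c u" using A by (rule presented_group_carrierE)
    obtain v where v: "v \<in> gwords S" "B = ?c v" using B by (rule presented_group_carrierE)
    obtain w where w: "w \<in> gwords S" "C = ?c w" using C by (rule presented_group_carrierE)
    have "u @ v \<in> gwords S" "v @ w \<in> gwords S" using u(1) v(1) w(1) by simp_all
    then show ?thesis
      using u v w by (simp only: presented_group_mult append_assoc)
  qed
  show "\<one>\<^bsub>?G\<^esub> \<otimes>\<^bsub>?G\<^esub> A = A" if A: "A \<in> carrier ?G" for A
  proof -
    obtain u where u: "u \<in> gwords S" "A = ?c u" using A by (rule presented_group_carrierE)
    have "[] \<in> gwords S" by simp
    then show ?thesis using u by (simp only: one presented_group_mult append_Nil)
  qed
  show "\<exists>B\<in>carrier ?G. B \<otimes>\<^bsub>?G\<^esub> A = \<one>\<^bsub>?G\<^esub>" if A: "A \<in> carrier ?G" for A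
  proof -
    obtain u where u: "u \<in> gwords S" "A = ?c u" using A by (rule presented_group_carrierE)
    let ?i = "map (\<lambda>(a, e). (a, \<not> e)) (rev u)"
    have i: "?i \<in> gwords S" using u(1) by (rule inverse_gword)
    have "?c ?i \<otimes>\<^bsub>?G\<^esub> A = \<one>\<^bsub>?G\<^esub>"
      unfolding u one presented_group_mult[OF i u(1)]
      by (rule equiv_class_eq[OF equiv_pres_rel pres_rel_left_inverse[OF u(1)]])
    then show ?thesis using presented_group_carrierI[OF i] by blast
  qed
qed


section \<open>The singular braid group\<close>

datatype sb_gen = Crossing nat | Singular nat

definition SB_gens :: "nat \<Rightarrow> sb_gen set" where
  "SB_gens n = Crossing ` {1..n - 1} \<union> Singular ` {1..n - 1}"

definition SB_rels :: "nat \<Rightarrow> (sb_gen gword \<times> sb_gen gword) set" where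
  "SB_rels n = (let s = (\<lambda>i. (Crossing i, True)); t = (\<lambda>i. (Singular i, True)) in
     {([s i, s (i + 1), s i], [s (i + 1), s i, s (i + 1)]) | i. i \<in> {1..n - 2}}
   \<union> {([s i, s (i + 1), t i], [t (i + 1), s i, s (i + 1)]) | i. i \<in> {1..n - 2}}
   \<union> {([s (i + 1), s i, t (i + 1)], [t i, s (i + 1), s i]) | i. i \<in> {1..n - 2}}
   \<union> {([t i, s i], [s i, t i]) | i. i \<in> {1..n - 1}}
   \<union> {([s i, s j], [s j, s i]) | i j.
        i \<in> {1..n - 1} \<and> j \<in> {1..n - 1} \<and> \<bar>int i - int j\<bar> \<ge> 2}
   \<union> {([t i, t j], [t j, t i]) | i j.
        i \<in> {1..n - 1} \<and> j \<in> {1..n - 1} \<and> \<bar>int i - int j\<bar> \<ge> 2}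
   \<union> {([t i, s j], [s j, t i]) | i j.
        i \<in> {1..n - 1} \<and> j \<in> {1..n - 1} \<and> \<bar>int i - int j\<bar> \<ge> 2})"

definition SB :: "nat \<Rightarrow> sb_gen gword set monoid" where
  "SB n = presented_group (SB_gens n) (SB_rels n)"

definition SB_sigma :: "nat \<Rightarrow> nat \<Rightarrow> sb_gen gword set" where
  "SB_sigma n i = pres_rel (SB_gens n) (SB_rels n) `` {[(Crossing i, True)]}"

definition SB_tau :: "nat \<Rightarrow> nat \<Rightarrow> sb_gen gword set" where
  "SB_tau n i = pres_rel (SB_gens n) (SB_rels n) `` {[(Singular i, True)]}"

lemma group_SB: "group (SB n)"
  unfolding SB_def by (rule group_presented_group)


section \<open>Complex matrix representations\<close>

definition GL :: "nat \<Rightarrow> complex mat monoid" where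
  "GL m = units_of (ring_mat TYPE(complex) m ())"

text \<open>A homomorphism from \<open>G\<close> to \<open>GL m\<close> is a representation of \<open>G\<close> on column vectors.\<close>

definition irreducible_rep :: "('g, 'e) monoid_scheme \<Rightarrow> nat \<Rightarrow> ('g \<Rightarrow> complex mat) \<Rightarrow> bool" where
  "irreducible_rep G m \<rho> \<longleftrightarrow>
     (\<forall>W. VectorSpace.subspace class_ring W (module_vec TYPE(complex) m) \<longrightarrow>
          (\<forall>g\<in>carrier G. \<forall>w\<in>W. \<rho> g *\<^sub>v w \<in> W) \<longrightarrow>
          W = {0\<^sub>v m} \<or> W = carrier_vec m)"

definition mat2 :: "'a \<Rightarrow> 'a \<Rightarrow> 'a \<Rightarrow> 'a \<Rightarrow> 'a mat" where
  "mat2 p q r s = mat_of_rows_list 2 [[p, q], [r, s]]"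

definition local_block :: "nat \<Rightarrow> nat \<Rightarrow> complex mat \<Rightarrow> complex mat" where
  "local_block n i A = diag_block_mat [1\<^sub>m (i - 1), A, 1\<^sub>m (n - i - 1)]"

end

theory Submission
  imports Defs
begin

text \<open>Let \<open>W\<close> be a nonzero invariant subspace; it is the whole space as soon as it contains one basis
  vector, since the \<open>\<sigma>\<^sub>i\<close> move the basis lines around. If \<open>bc \<noteq> 1\<close>, then \<open>\<sigma>\<^sub>i\<^sup>2 - 1\<close> is a nonzero
  multiple of the projection onto the coordinates \<open>i, i + 1\<close>, and for \<open>n \<ge> 3\<close> these projections
  isolate a nonzero coordinate of a vector of \<open>W\<close>. If \<open>bc = 1\<close>, then \<open>\<sigma>\<^sub>i - 1\<close> has rank one with image
  spanned by \<open>e\<^sub>i - c e\<^sub>i\<^sub>+\<^sub>1\<close>, and the common fixed vectors of the \<open>\<sigma>\<^sub>i\<close> are the multiples of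
  \<open>(1, c, c\<^sup>2, \<dots>)\<close>. The \<open>\<tau>\<^sub>i\<close> fix that vector iff \<open>x + y/b = 1\<close>; otherwise \<open>\<tau>\<^sub>1 - 1\<close> moves it off its
  line, so that \<open>W\<close> always contains some, hence all, \<open>e\<^sub>i - c e\<^sub>i\<^sub>+\<^sub>1\<close>, and \<open>\<tau>\<^sub>1 - 1\<close> applied to \<open>e\<^sub>2 - c e\<^sub>3\<close> yields \<open>e\<^sub>2\<close> modulo these.\<close>

section \<open>Block matrices acting on two adjacent coordinates\<close>

text \<open>Vector indices start at 0, so the paper's generators with index \<open>i = j + 1\<close> act on the
  coordinates \<open>j\<close> and \<open>j + 1\<close>.\<close>

definition pair_vec :: "nat \<Rightarrow> nat \<Rightarrow> 'a::zero \<Rightarrow> 'a \<Rightarrow> 'a vec" where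
  "pair_vec n j \<alpha> \<beta> = vec n (\<lambda>k. if k = j then \<alpha> else if k = Suc j then \<beta> else 0)"

lemma pair_vec_carrier [simp]: "pair_vec n j \<alpha> \<beta> \<in> carrier_vec n"
  by (simp add: pair_vec_def)

lemma dim_pair_vec [simp]: "dim_vec (pair_vec n j \<alpha> \<beta>) = n"
  by (simp add: pair_vec_def)

lemma index_pair_vec [simp]:
  "k < n \<Longrightarrow> pair_vec n j \<alpha> \<beta> $ k = (if k = j then \<alpha> else if k = Suc j then \<beta> else 0)"
  by (simp add: pair_vec_def)

lemma unit_vec_eq_pair_vec:
  "unit_vec n j = pair_vec n j 1 0"
  "unit_vec n (Suc j) = pair_vec n j 0 1"
  by (auto intro!: eq_vecI simp: unit_vec_def)

lemma local_block_eq: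
  assumes "Suc j < n"
  shows "local_block n (Suc j) (mat2 p q r s) = mat n n (\<lambda>(k, l).
    if k = j then (if l = j then p else if l = Suc j then q else 0)
    else if k = Suc j then (if l = j then r else if l = Suc j then s else 0)
    else (if l = k then 1 else 0))" (is "?A = mat n n ?f")
proof (rule eq_matI)
  show "dim_row ?A = dim_row (mat n n ?f)" "dim_col ?A = dim_col (mat n n ?f)"
    using assms by (simp_all add: local_block_def dim_diag_block_mat mat2_def mat_of_rows_list_def)
next
  fix k l
  assume "k < dim_row (mat n n ?f)" "l < dim_col (mat n n ?f)"
  then have kl: "k < n" "l < n" by simp_all
  have [simp]: "[[p, q], [r, s]] ! k' ! l' = (if k' = 0 then if l' = 0 then p else q
      else if l' = 0 then r else s)" if "k' < 2" "l' < 2" for k' l'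
    using that by (auto simp: less_2_cases_iff)
  show "?A $$ (k, l) = mat n n ?f $$ (k, l)"
    using assms kl
    by (auto simp: local_block_def Let_def mat2_def mat_of_rows_list_def four_block_mat_def)
qed

text \<open>Rows other than \<open>j\<close> and \<open>Suc j\<close> are those of the identity.
  Writing the image as \<open>w\<close> plus a correction lets \<open>w\<close> be subtracted inside
  an invariant subspace.\<close>

lemma local_block_mult_vec:
  assumes j: "Suc j < n" and w: "w \<in> carrier_vec n"
  shows "local_block n (Suc j) (mat2 p q r s) *\<^sub>v w =
    w + pair_vec n j ((p - 1) * w $ j + q * w $ Suc j) (r * w $ j + (s - 1) * w $ Suc j)"
proof (rule eq_vecI)
  fix k
  assume "k < dim_vec (w + pair_vec n j ((p - 1) * w $ j + q * w $ Suc j)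
    (r * w $ j + (s - 1) * w $ Suc j))"
  then have k: "k < n" by simp
  have two: "(\<Sum>l = 0..<n. (if l = j then \<alpha> else if l = Suc j then \<beta> else 0) * w $ l)
    = \<alpha> * w $ j + \<beta> * w $ Suc j" for \<alpha> \<beta> :: complex
  proof -
    have "(\<Sum>l = 0..<n. (if l = j then \<alpha> else if l = Suc j then \<beta> else 0) * w $ l)
      = (\<Sum>l = 0..<n. (if l = j then \<alpha> * w $ l else 0) + (if l = Suc j then \<beta> * w $ l else 0))"
      by (intro sum.cong) auto
    also have "\<dots> = \<alpha> * w $ j + \<beta> * w $ Suc j"
      using j by (simp add: sum.distrib)
    finally show ?thesis .
  qed
  have one: "(\<Sum>l = 0..<n. (if l = k then 1 else 0) * w $ l) = w $ k"
    using k by (simp add: if_distrib[of "\<lambda>t. t * _"] cong: if_cong)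
  show "(local_block n (Suc j) (mat2 p q r s) *\<^sub>v w) $ k =
    (w + pair_vec n j ((p - 1) * w $ j + q * w $ Suc j) (r * w $ j + (s - 1) * w $ Suc j)) $ k"
    using j k w two one
    by (auto simp: local_block_eq scalar_prod_def left_diff_distrib cong: sum.cong_simp)
qed (use assms in \<open>simp_all add: local_block_eq\<close>)

section \<open>Subspaces of the space of column vectors\<close>

context
  fixes n :: nat and W :: "complex vec set"
  assumes W: "VectorSpace.subspace class_ring W (module_vec TYPE(complex) n)"
begin

lemma
  shows subspace_vec_carrier: "w \<in> W \<Longrightarrow> w \<in> carrier_vec n"
    and subspace_vec_add: "v \<in> W \<Longrightarrow> w \<in> W \<Longrightarrow> v + w \<in> W"
    and subspace_vec_smult: "w \<in> W \<Longrightarrow> a \<cdot>\<^sub>v w \<in> W"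
    and subspace_vec_zero: "0\<^sub>v n \<in> W"
proof -
  interpret S: LinearCombinations.submodule class_ring W "module_vec TYPE(complex) n"
    using W by (simp add: VectorSpace.subspace_def)
  show "w \<in> W \<Longrightarrow> w \<in> carrier_vec n" "v \<in> W \<Longrightarrow> w \<in> W \<Longrightarrow> v + w \<in> W"
    "w \<in> W \<Longrightarrow> a \<cdot>\<^sub>v w \<in> W" "0\<^sub>v n \<in> W"
    using S.subset S.m_closed S.smult_closed S.zero_closed
    by (auto simp: module_vec_simps class_ring_simps)
qed

lemma subspace_vec_lincomb:
  "v \<in> W \<Longrightarrow> w \<in> W \<Longrightarrow> \<alpha> \<cdot>\<^sub>v v + \<beta> \<cdot>\<^sub>v w \<in> W"
  by (intro subspace_vec_add subspace_vec_smult)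

text \<open>The sum is recorded through its coordinates only, because the zero vector that starts it
  depends on the dimension \<open>n\<close>.\<close>

lemma subspace_vec_sum:
  assumes "finite I" "\<And>i. i \<in> I \<Longrightarrow> f i \<in> W"
  shows "\<exists>u\<in>W. \<forall>k<n. u $ k = (\<Sum>i\<in>I. f i $ k)"
  using assms
proof (induction I)
  case empty
  show ?case using subspace_vec_zero by (intro bexI[of _ "0\<^sub>v n"]) auto
next
  case (insert i I)
  then obtain u where "u \<in> W" "\<forall>k<n. u $ k = (\<Sum>i\<in>I. f i $ k)" by auto
  moreover from this have "u \<in> carrier_vec n" by (intro subspace_vec_carrier)
  ultimately show ?case using insert
    by (intro bexI[of _ "f i + u"] subspace_vec_add) auto
qed

lemma subspace_vec_eq_carrierI:
  assumes "\<And>k. k < n \<Longrightarrow> unit_vec n k \<in> W"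
  shows "W = carrier_vec n"
proof
  show "W \<subseteq> carrier_vec n" using subspace_vec_carrier by blast
  show "carrier_vec n \<subseteq> W"
  proof
    fix w :: "complex vec" assume w: "w \<in> carrier_vec n"
    obtain u where u: "u \<in> W" "\<forall>k<n. u $ k = (\<Sum>i<n. (w $ i \<cdot>\<^sub>v unit_vec n i) $ k)"
      using subspace_vec_sum[of "{..<n}" "\<lambda>i. w $ i \<cdot>\<^sub>v unit_vec n i"] assms subspace_vec_smult
      by auto
    have "(\<Sum>i<n. (w $ i \<cdot>\<^sub>v unit_vec n i) $ k) = w $ k" if "k < n" for k
    proof -
      have "(\<Sum>i<n. (w $ i \<cdot>\<^sub>v unit_vec n i) $ k) = (\<Sum>i<n. if i = k then w $ i else 0)"
        using that by (intro sum.cong) auto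
      also have "\<dots> = w $ k" using that by simp
      finally show ?thesis .
    qed
    then have "u = w" using u w subspace_vec_carrier[OF u(1)] by (intro eq_vecI) auto
    then show "w \<in> W" using u by simp
  qed
qed

lemma pair_vec_in_subspace_scaled:
  assumes "pair_vec n j \<alpha> \<beta> \<in> W"
  shows "pair_vec n j (t * \<alpha>) (t * \<beta>) \<in> W"
proof -
  have "pair_vec n j (t * \<alpha>) (t * \<beta>) = t \<cdot>\<^sub>v pair_vec n j \<alpha> \<beta>"
    by (intro eq_vecI) auto
  then show ?thesis using subspace_vec_smult[OF assms] by simp
qed

lemma pair_vec_in_subspace_add:
  assumes "pair_vec n j \<alpha> \<beta> \<in> W" "pair_vec n j \<alpha>' \<beta>' \<in> W"
  shows "pair_vec n j (\<alpha> + \<alpha>') (\<beta> + \<beta>') \<in> W"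
proof -
  have "pair_vec n j (\<alpha> + \<alpha>') (\<beta> + \<beta>') = pair_vec n j \<alpha> \<beta> + pair_vec n j \<alpha>' \<beta>'"
    by (intro eq_vecI) auto
  then show ?thesis using subspace_vec_add[OF assms] by simp
qed

text \<open>The image of \<open>w\<close> minus \<open>w\<close> lies in \<open>W\<close> and is
  exactly the correction term. All later elements of \<open>W\<close> are extracted this
  way.\<close>

lemma local_block_invariant:
  assumes inv: "\<And>w. w \<in> W \<Longrightarrow> local_block n (Suc j) (mat2 p q r s) *\<^sub>v w \<in> W"
    and w: "w \<in> W" and j: "Suc j < n"
  shows "pair_vec n j ((p - 1) * w $ j + q * w $ Suc j) (r * w $ j + (s - 1) * w $ Suc j) \<in> W"
    (is "?u \<in> W")
proof -
  have wc: "w \<in> carrier_vec n" using w by (rule subspace_vec_carrier)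
  have "w + ?u \<in> W"
    using inv[OF w] by (simp add: local_block_mult_vec[OF j wc])
  then have "(w + ?u) + (-1) \<cdot>\<^sub>v w \<in> W"
    using subspace_vec_smult[OF w] by (rule subspace_vec_add)
  moreover have "(w + ?u) + (-1) \<cdot>\<^sub>v w = ?u"
    using wc by (intro eq_vecI) auto
  ultimately show ?thesis by simp
qed

section \<open>Subspaces invariant under every \<sigma>\<close>

context
  fixes b c :: complex
  assumes b: "b \<noteq> 0" and c: "c \<noteq> 0"
    and sigma: "\<And>j w. Suc j < n \<Longrightarrow> w \<in> W \<Longrightarrow> local_block n (Suc j) (mat2 0 b c 0) *\<^sub>v w \<in> W"
begin

lemma sigma_diff:
  "Suc j < n \<Longrightarrow> w \<in> W \<Longrightarrow> pair_vec n j (b * w $ Suc j - w $ j) (c * w $ j - w $ Suc j) \<in> W"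
  using local_block_invariant[OF sigma, of j w] by (simp add: algebra_simps)

text \<open>Up to the nonzero factors \<open>b\<close> and \<open>c\<close>, \<sigma> swaps the two
  unit vectors of its plane.\<close>

lemma unit_vec_Suc_iff:
  assumes j: "Suc j < n"
  shows "unit_vec n j \<in> W \<longleftrightarrow> unit_vec n (Suc j) \<in> W"
proof
  assume e: "unit_vec n j \<in> W"
  have "pair_vec n j 1 0 \<in> W" using e by (simp add: unit_vec_eq_pair_vec)
  \<comment> \<open>This is the image of the unit vector under \<sigma> - 1; adding the unit vector
    back cancels the entry -1.\<close>
  moreover have "pair_vec n j (-1) c \<in> W" using sigma_diff[OF j e] j by simp
  ultimately have "pair_vec n j (inverse c * (1 + -1)) (inverse c * (0 + c)) \<in> W"
    by (intro pair_vec_in_subspace_scaled pair_vec_in_subspace_add)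
  then show "unit_vec n (Suc j) \<in> W" using c by (simp add: unit_vec_eq_pair_vec(2))
next
  assume e: "unit_vec n (Suc j) \<in> W"
  have "pair_vec n j 0 1 \<in> W" using e by (simp add: unit_vec_eq_pair_vec(2))
  moreover have "pair_vec n j b (-1) \<in> W" using sigma_diff[OF j e] j by simp
  ultimately have "pair_vec n j (inverse b * (0 + b)) (inverse b * (1 + -1)) \<in> W"
    by (intro pair_vec_in_subspace_scaled pair_vec_in_subspace_add)
  then show "unit_vec n j \<in> W" using b by (simp add: unit_vec_eq_pair_vec)
qed

lemma whole_space_if_unit_vec:
  assumes k: "k < n" and e: "unit_vec n k \<in> W"
  shows "W = carrier_vec n"
proof (rule subspace_vec_eq_carrierI)
  have iff: "unit_vec n l \<in> W \<longleftrightarrow> unit_vec n 0 \<in> W" if "l < n" for l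
    using that by (induction l) (auto simp: unit_vec_Suc_iff)
  show "unit_vec n l \<in> W" if "l < n" for l
    using iff[OF that] iff[OF k] e by simp
qed

lemma whole_space_if_scaled_unit_vec:
  assumes k: "k < n" and t: "t \<noteq> 0" and e: "t \<cdot>\<^sub>v unit_vec n k \<in> W"
  shows "W = carrier_vec n"
proof (rule whole_space_if_unit_vec[OF k])
  have "inverse t \<cdot>\<^sub>v (t \<cdot>\<^sub>v unit_vec n k) \<in> W" using e by (rule subspace_vec_smult)
  then show "unit_vec n k \<in> W" using t by (simp add: smult_smult_assoc)
qed

text \<open>On the plane of the two coordinates involved, \<open>\<sigma>\<close> squares to \<open>bc\<close>, so \<open>(\<sigma>\<^sup>2 - 1)/(bc - 1)\<close>
  is the projection onto that plane.\<close>

lemma plane_projection: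
  assumes bc: "b * c \<noteq> 1" and j: "Suc j < n" and w: "w \<in> W"
  shows "pair_vec n j (w $ j) (w $ Suc j) \<in> W"
proof -
  let ?p = "b * w $ Suc j - w $ j" and ?q = "c * w $ j - w $ Suc j"
  have 1: "pair_vec n j ?p ?q \<in> W" using sigma_diff[OF j w] .
  have 2: "pair_vec n j (b * ?q - ?p) (c * ?p - ?q) \<in> W"
    using sigma_diff[OF j 1] j by simp
  let ?t = "inverse (b * c - 1)"
  \<comment> \<open>With s = \<sigma> - 1, facts \<open>1\<close> and \<open>2\<close> give s w and
    s (s w), and \<sigma> squared minus 1 equals s s + 2 s.\<close>
  have "pair_vec n j (?t * ((b * ?q - ?p) + 2 * ?p)) (?t * ((c * ?p - ?q) + 2 * ?q)) \<in> W"
    using 1 2 by (intro pair_vec_in_subspace_scaled pair_vec_in_subspace_add)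
  moreover have "?t * ((b * ?q - ?p) + 2 * ?p) = w $ j" "?t * ((c * ?p - ?q) + 2 * ?q) = w $ Suc j"
    using bc by (simp_all add: field_simps)
  ultimately show ?thesis by simp
qed

text \<open>Two neighbouring coordinate planes meet in a line, so composing their projections
  isolates any interior coordinate.\<close>

lemma whole_space_if_bc_ne_1:
  assumes bc: "b * c \<noteq> 1" and n: "n \<ge> 3" and w: "w \<in> W" and k: "k < n" and wk: "w $ k \<noteq> 0"
  shows "W = carrier_vec n"
proof -
  have inner: "w $ Suc j \<cdot>\<^sub>v unit_vec n (Suc j) \<in> W" if j: "Suc (Suc j) < n" for j
  proof -
    have "pair_vec n (Suc j) (w $ Suc j) (w $ Suc (Suc j)) \<in> W"
      using plane_projection[OF bc j w] .
    from plane_projection[OF bc _ this, of j] j have "pair_vec n j 0 (w $ Suc j) \<in> W"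
      by simp
    moreover have "pair_vec n j 0 (w $ Suc j) = w $ Suc j \<cdot>\<^sub>v unit_vec n (Suc j)"
      by (intro eq_vecI) (auto simp: unit_vec_eq_pair_vec)
    ultimately show ?thesis by simp
  qed
  have "w $ k \<cdot>\<^sub>v unit_vec n k \<in> W"
  proof -
    \<comment> \<open>First, interior or last coordinate. At either end the neighbour is interior
      because \<open>n \<ge> 3\<close>, so its part can be subtracted from the plane
      projection.\<close>
    consider "k = 0" | j where "k = Suc j" "Suc (Suc j) < n" | j where "k = Suc (Suc j)" "Suc k = n"
      using k n by (cases k; cases "k - 1") (auto, linarith)
    then show ?thesis
    proof cases
      case 1
      have "1 \<cdot>\<^sub>v pair_vec n 0 (w $ 0) (w $ Suc 0) + (-1) \<cdot>\<^sub>v (w $ Suc 0 \<cdot>\<^sub>v unit_vec n (Suc 0)) \<in> W"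
        using plane_projection[OF bc _ w, of 0] inner[of 0] n by (intro subspace_vec_lincomb) simp_all
      moreover have "1 \<cdot>\<^sub>v pair_vec n 0 (w $ 0) (w $ Suc 0) + (-1) \<cdot>\<^sub>v (w $ Suc 0 \<cdot>\<^sub>v unit_vec n (Suc 0))
        = w $ k \<cdot>\<^sub>v unit_vec n k"
        using 1 n by (intro eq_vecI) auto
      ultimately show ?thesis by simp
    next
      case (2 j)
      then show ?thesis using inner by simp
    next
      case (3 j)
      have "1 \<cdot>\<^sub>v pair_vec n (Suc j) (w $ Suc j) (w $ k) + (-1) \<cdot>\<^sub>v (w $ Suc j \<cdot>\<^sub>v unit_vec n (Suc j)) \<in> W"
        using plane_projection[OF bc _ w, of "Suc j"] inner[of j] 3
        by (intro subspace_vec_lincomb) simp_all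
      moreover have "1 \<cdot>\<^sub>v pair_vec n (Suc j) (w $ Suc j) (w $ k)
          + (-1) \<cdot>\<^sub>v (w $ Suc j \<cdot>\<^sub>v unit_vec n (Suc j)) = w $ k \<cdot>\<^sub>v unit_vec n k"
        using 3 by (intro eq_vecI) auto
      ultimately show ?thesis by simp
    qed
  qed
  then show ?thesis using whole_space_if_scaled_unit_vec k wk by blast
qed

section \<open>The case bc = 1 with x + y/b different from 1\<close>

context
  fixes x y :: complex
  assumes bc: "b * c = 1" and n: "n \<ge> 3" and xy: "x + y / b \<noteq> 1"
    and tau: "\<And>j w. Suc j < n \<Longrightarrow> w \<in> W
      \<Longrightarrow> local_block n (Suc j) (mat2 x y (c * y / b) x) *\<^sub>v w \<in> W"
begin

lemma c_eq: "c = inverse b"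
  using bc b by (simp add: field_simps)

text \<open>Adjacent blocks share one coordinate, at which either vector is nonzero. Hence \<sigma>
  - 1 for the other block maps it to a nonzero multiple (\<open>c\<close> or \<open>b\<close>) of
  the other vector.\<close>

lemma difference_vec_Suc_iff:
  assumes j: "Suc (Suc j) < n"
  shows "pair_vec n j 1 (- c) \<in> W \<longleftrightarrow> pair_vec n (Suc j) 1 (- c) \<in> W"
proof
  assume d: "pair_vec n j 1 (- c) \<in> W"
  from sigma_diff[OF j d] j have "pair_vec n (Suc j) c (- (c * c)) \<in> W"
    by simp
  from pair_vec_in_subspace_scaled[OF this, of b] show "pair_vec n (Suc j) 1 (- c) \<in> W"
    by (simp add: c_eq b flip: mult.assoc)
next
  assume d: "pair_vec n (Suc j) 1 (- c) \<in> W"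
  from sigma_diff[OF _ d, of j] j have "pair_vec n j b (- 1) \<in> W"
    by simp
  from pair_vec_in_subspace_scaled[OF this, of c] show "pair_vec n j 1 (- c) \<in> W"
    using bc by (simp add: algebra_simps)
qed

text \<open>One such vector gives all of them; those at positions 0 and 1, together with the first
  \<tau>, produce a nonzero multiple of a unit vector.\<close>

lemma whole_space_if_difference_vec:
  assumes k: "Suc k < n" and d: "pair_vec n k 1 (- c) \<in> W"
  shows "W = carrier_vec n"
proof -
  have iff: "pair_vec n l 1 (- c) \<in> W \<longleftrightarrow> pair_vec n 0 1 (- c) \<in> W" if "Suc l < n" for l
    using that by (induction l) (auto simp: difference_vec_Suc_iff)
  have d0: "pair_vec n 0 1 (- c) \<in> W" and d1: "pair_vec n 1 1 (- c) \<in> W"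
    using iff[of 1] iff[OF k] d n by auto
  have "pair_vec n 0 y (x - 1) \<in> W"
    using local_block_invariant[OF tau d1, of 0] n by simp
  \<comment> \<open>Subtracting \<open>y\<close> times \<open>d0\<close> clears coordinate 0 and
    leaves x - 1 + cy, which is x + y/b - 1, in coordinate 1.\<close>
  then have "pair_vec n 0 (y + (- y) * 1) ((x - 1) + (- y) * (- c)) \<in> W"
    using d0 by (intro pair_vec_in_subspace_add pair_vec_in_subspace_scaled)
  moreover have "pair_vec n 0 (y + (- y) * 1) ((x - 1) + (- y) * (- c))
      = (x + y / b - 1) \<cdot>\<^sub>v unit_vec n 1"
    using b by (intro eq_vecI) (auto simp: unit_vec_eq_pair_vec(2)[of n 0, simplified] c_eq field_simps)
  ultimately show ?thesis
    using whole_space_if_scaled_unit_vec[of 1 "x + y / b - 1"] xy n by simp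
qed

text \<open>Since bc = 1, \<sigma> - 1 sends \<open>w\<close> to \<open>?t\<close> times the
  difference vector, and \<open>?t\<close> is nonzero exactly when proportionality fails.\<close>

lemma whole_space_if_not_proportional:
  assumes j: "Suc j < n" and w: "w \<in> W" and ne: "w $ j \<noteq> b * w $ Suc j"
  shows "W = carrier_vec n"
proof (rule whole_space_if_difference_vec[OF j])
  let ?t = "b * w $ Suc j - w $ j"
  have "pair_vec n j (inverse ?t * ?t) (inverse ?t * (c * w $ j - w $ Suc j)) \<in> W"
    using sigma_diff[OF j w] by (rule pair_vec_in_subspace_scaled)
  moreover have "c * w $ j - w $ Suc j = - c * ?t"
    using b by (simp add: c_eq field_simps)
  moreover have "?t \<noteq> 0" using ne by simp
  ultimately show "pair_vec n j 1 (- c) \<in> W" by (simp add: mult.left_commute[of _ c])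
qed

text \<open>If \<open>w\<close> is proportional at every position, all \<sigma> fix it; the first
  \<tau> then yields a vector of \<open>W\<close> that is not proportional.\<close>

lemma whole_space_if_bc_eq_1:
  assumes w: "w \<in> W" and k: "k < n" and wk: "w $ k \<noteq> 0"
  shows "W = carrier_vec n"
proof (cases "\<forall>j. Suc j < n \<longrightarrow> w $ j = b * w $ Suc j")
  case False
  then show ?thesis using whole_space_if_not_proportional w by blast
next
  case True
  have "w $ 0 = b ^ l * w $ l" if "l < n" for l
    using that by (induction l) (use True in auto)
  from this[OF k] this[of 1] have w1: "w $ 1 \<noteq> 0" "w $ 0 = b * w $ 1"
    using b wk n by auto
  let ?u = "pair_vec n 0 ((x - 1) * w $ 0 + y * w $ 1) ((c * y / b) * w $ 0 + (x - 1) * w $ 1)"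
  have u: "?u \<in> W"
    using local_block_invariant[OF tau w, of 0] n by simp
  have "?u $ 1 = (x + y / b - 1) * w $ 1"
    using n w1 b by (simp add: c_eq field_simps)
  \<comment> \<open>Coordinate 2 of \<open>?u\<close> is 0, while coordinate 1 is not.\<close>
  then have "?u $ 1 \<noteq> b * ?u $ Suc 1" using xy w1 n by simp
  then show ?thesis using whole_space_if_not_proportional[OF _ u, of 1] n by simp
qed

end
end
end

section \<open>Fixed vectors, invariant lines and the reducible case\<close>

text \<open>A matrix fixing \<open>v\<close> has an inverse fixing \<open>v\<close>, so formal
  inverses are covered as well; induction on words then reaches the whole group.\<close>

lemma fixed_vec_presented_group:
  assumes hom: "\<phi> \<in> hom (presented_group S R) (GL m)" and v: "v \<in> carrier_vec m"
    and gen: "\<And>a. a \<in> S \<Longrightarrow> \<phi> (pres_rel S R `` {[(a, True)]}) *\<^sub>v v = v"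
    and g: "g \<in> carrier (presented_group S R)"
  shows "\<phi> g *\<^sub>v v = v"
proof -
  let ?G = "presented_group S R" and ?c = "\<lambda>u. pres_rel S R `` {u}"
  interpret M: ring "ring_mat TYPE(complex) m ()" by (rule ring_mat)
  interpret group_hom ?G "GL m" \<phi>
    using group_presented_group hom M.units_group
    by (auto simp: group_hom_def group_hom_axioms_def GL_def)
  have carr: "\<phi> h \<in> carrier_mat m m" if "h \<in> carrier ?G" for h
    using hom_closed[OF that] by (auto simp: GL_def units_of_def Units_def ring_mat_def)
  have mult: "\<phi> (h \<otimes>\<^bsub>?G\<^esub> k) *\<^sub>v v = \<phi> h *\<^sub>v (\<phi> k *\<^sub>v v)"
    if "h \<in> carrier ?G" "k \<in> carrier ?G" for h k
    using assoc_mult_mat_vec[OF carr[OF that(1)] carr[OF that(2)] v]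
    by (simp add: hom_mult[OF that]) (simp add: GL_def units_of_def ring_mat_def)
  have one: "\<phi> (?c []) *\<^sub>v v = v"
    using hom_one v by (simp add: presented_group_def GL_def units_of_def ring_mat_def)
  have letter: "\<phi> (?c [(a, e)]) *\<^sub>v v = v" if a: "a \<in> S" for a e
  proof (cases e)
    case True
    then show ?thesis using gen[OF a] by simp
  next
    case False
    have w: "[(a, e)] \<in> gwords S" for e using a by simp
    have "?c [(a, False)] \<otimes>\<^bsub>?G\<^esub> ?c [(a, True)] = ?c []"
      unfolding presented_group_mult[OF w w]
      using pres_rel.cancel[OF a, of "[]" "[]" False R]
      by (intro equiv_class_eq[OF equiv_pres_rel]) simp
    with mult[OF presented_group_carrierI[OF w] presented_group_carrierI[OF w], of False True]
    have "\<phi> (?c [(a, False)]) *\<^sub>v v = v" by (simp add: one gen[OF a])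
    then show ?thesis using False by simp
  qed
  obtain u where "u \<in> gwords S" "g = ?c u" using g by (rule presented_group_carrierE)
  have "\<phi> (?c u) *\<^sub>v v = v"
    using \<open>u \<in> gwords S\<close>
  proof (induction u)
    case Nil
    show ?case by (rule one)
  next
    case (Cons l u)
    obtain a e where l: "l = (a, e)" by (cases l)
    then have a: "a \<in> S" using Cons.hyps by simp
    have w: "[(a, e)] \<in> gwords S" using a by simp
    have "?c (l # u) = ?c [(a, e)] \<otimes>\<^bsub>?G\<^esub> ?c u"
      using presented_group_mult[OF w Cons.hyps(2)] l by simp
    then show ?case
      using mult[OF presented_group_carrierI[OF w] presented_group_carrierI[OF Cons.hyps(2)]]
      by (simp add: Cons.IH letter[OF a])
  qed
  then show ?thesis using \<open>g = ?c u\<close> by simp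
qed

lemma subspace_line:
  assumes v: "v \<in> carrier_vec n"
  shows "VectorSpace.subspace class_ring (range (\<lambda>a. a \<cdot>\<^sub>v v)) (module_vec TYPE(complex) n)"
proof -
  have "LinearCombinations.submodule class_ring (range (\<lambda>a. a \<cdot>\<^sub>v v)) (module_vec TYPE(complex) n)"
  proof (rule LinearCombinations.submodule.intro)
    show "module (class_ring :: complex ring) (module_vec TYPE(complex) n)" by (rule vec_module)
    have "0\<^sub>v n = 0 \<cdot>\<^sub>v v" using v by (intro eq_vecI) auto
    then show "\<zero>\<^bsub>module_vec TYPE(complex) n\<^esub> \<in> range (\<lambda>a. a \<cdot>\<^sub>v v)"
      unfolding module_vec_simps by blast
  qed (use v in \<open>auto simp: module_vec_simps class_ring_simps smult_smult_assoc
        simp flip: add_smult_distrib_vec\<close>)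
  then show ?thesis by (simp add: VectorSpace.subspace_def vec_vs)
qed

lemma SB_sigma_carrier: "Suc j < n \<Longrightarrow> SB_sigma n (Suc j) \<in> carrier (SB n)"
  unfolding SB_sigma_def SB_def by (rule presented_group_carrierI) (auto simp: SB_gens_def)

lemma SB_tau_carrier: "Suc j < n \<Longrightarrow> SB_tau n (Suc j) \<in> carrier (SB n)"
  unfolding SB_tau_def SB_def by (rule presented_group_carrierI) (auto simp: SB_gens_def)

theorem theorem29:
  fixes n :: nat and b c x y :: complex
    and \<rho>\<^sub>3 :: "sb_gen gword set \<Rightarrow> complex mat"
  assumes "n \<ge> 3"
    and "b \<noteq> 0" and "c \<noteq> 0" and "x\<^sup>2 - c * y\<^sup>2 / b \<noteq> 0"
    and "\<rho>\<^sub>3 \<in> hom (SB n) (GL n)"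
    and "\<And>i. 1 \<le> i \<Longrightarrow> i \<le> n - 1 \<Longrightarrow>
           \<rho>\<^sub>3 (SB_sigma n i) = local_block n i (mat2 0 b c 0)"
    and "\<And>i. 1 \<le> i \<Longrightarrow> i \<le> n - 1 \<Longrightarrow>
           \<rho>\<^sub>3 (SB_tau n i) = local_block n i (mat2 x y (c * y / b) x)"
  shows "(b * c \<noteq> 1 \<longrightarrow> irreducible_rep (SB n) n \<rho>\<^sub>3) \<and>
         (b * c = 1 \<longrightarrow> (irreducible_rep (SB n) n \<rho>\<^sub>3 \<longleftrightarrow> x + y / b \<noteq> 1))"
proof -
  \<comment> \<open>A single disjunction covers both irreducibility claims.\<close>
  have irr: "irreducible_rep (SB n) n \<rho>\<^sub>3" if nondeg: "b * c \<noteq> 1 \<or> x + y / b \<noteq> 1"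
    unfolding irreducible_rep_def
  proof (intro allI impI)
    fix W
    assume W: "VectorSpace.subspace class_ring W (module_vec TYPE(complex) n)"
      and inv: "\<forall>g\<in>carrier (SB n). \<forall>w\<in>W. \<rho>\<^sub>3 g *\<^sub>v w \<in> W"
    have sigma: "local_block n (Suc j) (mat2 0 b c 0) *\<^sub>v w \<in> W" if "Suc j < n" "w \<in> W" for j w
      using inv SB_sigma_carrier[OF that(1)] assms(6)[of "Suc j"] that by auto
    have tau: "local_block n (Suc j) (mat2 x y (c * y / b) x) *\<^sub>v w \<in> W"
      if "Suc j < n" "w \<in> W" for j w
      using inv SB_tau_carrier[OF that(1)] assms(7)[of "Suc j"] that by auto
    show "W = {0\<^sub>v n} \<or> W = carrier_vec n"
    proof (cases "W = {0\<^sub>v n}")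
      case False
      then obtain w where w: "w \<in> W" "w \<noteq> 0\<^sub>v n" using subspace_vec_zero[OF W] by blast
      then obtain k where k: "k < n" "w $ k \<noteq> 0"
        using subspace_vec_carrier[OF W w(1)] by (metis carrier_vecD eq_vecI index_zero_vec)
      show ?thesis
      proof (cases "b * c = 1")
        case True
        then show ?thesis
          using whole_space_if_bc_eq_1[OF W assms(2,3) sigma True assms(1) _ tau w(1) k] nondeg by blast
      next
        case False
        then show ?thesis
          using whole_space_if_bc_ne_1[OF W assms(2,3) sigma False assms(1) w(1) k] by blast
      qed
    qed simp
  qed
  have "\<not> irreducible_rep (SB n) n \<rho>\<^sub>3" if bc: "b * c = 1" and xy: "x + y / b = 1"
  proof
    assume irr: "irreducible_rep (SB n) n \<rho>\<^sub>3"
    \<comment> \<open>The entries satisfy \<open>v $ j = b * v $ Suc j\<close>, the condition for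
      being fixed by \<sigma> when bc = 1. Its span is the invariant line.\<close>
    define v where "v = vec n (\<lambda>k. c ^ k)"
    have v: "v \<in> carrier_vec n" by (simp add: v_def)
    have c: "c = inverse b" using bc assms(2) by (simp add: field_simps)
    have x: "x = 1 - y / b" using xy by (simp add: algebra_simps)
    have pair_zero: "v + pair_vec n j 0 0 = v" for j
      using v by (intro eq_vecI) auto
    have "\<rho>\<^sub>3 (SB_sigma n i) *\<^sub>v v = v" "\<rho>\<^sub>3 (SB_tau n i) *\<^sub>v v = v"
      if i: "1 \<le> i" "i \<le> n - 1" for i
    proof -
      obtain j where j: "i = Suc j" "Suc j < n" using i assms(1) by (cases i) auto
      have vj: "v $ Suc j = c * v $ j" using j by (simp add: v_def)
      show "\<rho>\<^sub>3 (SB_sigma n i) *\<^sub>v v = v"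
        using j bc by (simp add: assms(6)[OF i[unfolded j(1)]] local_block_mult_vec[OF j(2) v] vj
            pair_zero flip: mult.assoc)
      \<comment> \<open>These are the two entries of the correction term for \<tau>; both vanish
        because x - 1 = -y/b and c = 1/b.\<close>
      have "(x - 1) * v $ j + y * (c * v $ j) = 0" "c * y / b * v $ j + (x - 1) * (c * v $ j) = 0"
        using assms(2) by (simp_all add: c x field_simps)
      then show "\<rho>\<^sub>3 (SB_tau n i) *\<^sub>v v = v"
        using j by (simp add: assms(7)[OF i[unfolded j(1)]] local_block_mult_vec[OF j(2) v] vj pair_zero)
    qed
    then have "\<rho>\<^sub>3 (pres_rel (SB_gens n) (SB_rels n) `` {[(a, True)]}) *\<^sub>v v = v"
      if "a \<in> SB_gens n" for a
      using that by (auto simp only: SB_gens_def SB_sigma_def SB_tau_def atLeastAtMost_iff)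
    then have fixed: "\<rho>\<^sub>3 g *\<^sub>v v = v" if "g \<in> carrier (SB n)" for g
      using fixed_vec_presented_group[OF assms(5)[unfolded SB_def] v _ that[unfolded SB_def]]
      by blast
    have inv: "\<rho>\<^sub>3 g *\<^sub>v w \<in> range (\<lambda>a. a \<cdot>\<^sub>v v)"
      if g: "g \<in> carrier (SB n)" and w: "w \<in> range (\<lambda>a. a \<cdot>\<^sub>v v)" for g w
    proof -
      have "\<rho>\<^sub>3 g \<in> carrier (GL n)" using assms(5) g by (auto simp: hom_def)
      then have "\<rho>\<^sub>3 g \<in> carrier_mat n n" by (auto simp: GL_def units_of_def Units_def ring_mat_def)
      then show ?thesis using w v fixed[OF g] by (auto simp: mult_mat_vec)
    qed
    from irr subspace_line[OF v] inv
    have "range (\<lambda>a. a \<cdot>\<^sub>v v) = {0\<^sub>v n} \<or> range (\<lambda>a. a \<cdot>\<^sub>v v) = carrier_vec n"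
      unfolding irreducible_rep_def by blast
    then show False
    proof
      assume "range (\<lambda>a. a \<cdot>\<^sub>v v) = {0\<^sub>v n}"
      then have "1 \<cdot>\<^sub>v v = 0\<^sub>v n" by blast
      then have "(1 \<cdot>\<^sub>v v) $ 0 = 0\<^sub>v n $ 0" by simp
      then show False using assms(1) by (simp add: v_def)
    next
      assume "range (\<lambda>a. a \<cdot>\<^sub>v v) = carrier_vec n"
      then obtain a where a: "unit_vec n 0 = a \<cdot>\<^sub>v v" using unit_vec_carrier[of n 0] by blast
      \<comment> \<open>Coordinate 0 forces a = 1, and coordinate 1 then forces c = 0.\<close>
      then have "unit_vec n 0 $ 0 = (a \<cdot>\<^sub>v v) $ 0" "unit_vec n 0 $ 1 = (a \<cdot>\<^sub>v v) $ 1" by simp_all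
      then show False using assms(1,3) by (simp add: v_def)
    qed
  qed
  with irr show ?thesis by blast
qed

end
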